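(* Let $X$ be a real or complex vector space. Then $X$ is finite-dimensional if and only if every linear operator $A : X \to X$ that is right-sided invertible is invertible.
   Context: Let $X$ be a real or complex vector space and let $I$ denote the identity operator on $X$. A linear operator on $X$ is a linear map $A : X \to X$ defined on all of $X$. A linear operator $A : X \to X$ is called right-sided invertible if it has a right inverse, i.e., if there exists a linear operator $C : X \to X$ such that $AC = I$. A linear operator $A : X \to X$ is called invertible if it is injective, i.e., $\ker A = \{0\}$, equivalently, if there exists an inverse operator $A^{-1} : R(A) \to X$ defined on the range $R(A)$ of $A$. *)

theory Defs
  imports Complex_Main
begin

text \<open>
  A vector space is a type of class \<^class>\<open>ab_group_add\<close> together with a scalar multiplication
  \<open>s\<close> satisfying \<^const>\<open>vector_space\<close>. The scalar multiplication is an explicit parameter so that the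
  same notions serve the real and the complex case.
\<close>

definition finite_dimensional :: "('k::field \<Rightarrow> 'a::ab_group_add \<Rightarrow> 'a) \<Rightarrow> bool" where
  "finite_dimensional s \<longleftrightarrow> (\<exists>B. finite_dimensional_vector_space s B)"

definition linear_operator :: "('k::field \<Rightarrow> 'a::ab_group_add \<Rightarrow> 'a) \<Rightarrow> ('a \<Rightarrow> 'a) \<Rightarrow> bool" where
  "linear_operator s A \<longleftrightarrow> Vector_Spaces.linear s s A"

definition right_sided_invertible :: "('k::field \<Rightarrow> 'a::ab_group_add \<Rightarrow> 'a) \<Rightarrow> ('a \<Rightarrow> 'a) \<Rightarrow> bool" where
  "right_sided_invertible s A \<longleftrightarrow> (\<exists>C. linear_operator s C \<and> A \<circ> C = id)"

text \<open>
  Invertibility only asks for an inverse defined on the range, that is, for injectivity;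
  surjectivity is not required.
\<close>

definition invertible_operator :: "('a \<Rightarrow> 'a) \<Rightarrow> bool" where
  "invertible_operator A \<longleftrightarrow> inj A"

end

theory Submission
  imports Defs
begin

text \<open>
  Both directions hold over an arbitrary field, and the real and the complex case are two
  instances of the same equivalence.

  In finite dimension a right-sided invertible operator is surjective, and rank-nullity makes a
  surjective endomorphism injective.

  In infinite dimension there is an infinite Hamel basis \<open>B\<close>, and an infinite set can be mapped
  bijectively onto itself with one point \<open>b\<close> removed. Such a map \<open>h\<close> plays the role of the
  shift on sequences: its linear extension \<open>C\<close> is a forward shift, and the backward
  shift \<open>A\<close>, which undoes \<open>h\<close> on \<open>B - {b}\<close> and kills \<open>b\<close>, satisfies \<open>A \<circ> C = id\<close> without
  being injective.
\<close>

context finite_dimensional_vector_space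
begin

lemma right_sided_invertible_imp_invertible:
  assumes "linear_operator scale A" and "right_sided_invertible scale A"
  shows "invertible_operator A"
proof -
  obtain C where "A \<circ> C = id"
    using assms(2) unfolding right_sided_invertible_def by blast
  hence "surj A"
    by (intro surjI[of A C]) (simp add: pointfree_idE)
  thus ?thesis
    using assms(1) unfolding linear_operator_def invertible_operator_def
    by (intro linear_surj_imp_inj)
qed

end

context vector_space
begin

text \<open>
  The model is the backward shift on finitely supported sequences, with a bijection
  \<open>B \<rightarrow> B - {b}\<close> in place of the successor function. A composition of linear maps that fixes
  every vector of a spanning set is the identity, so \<open>A \<circ> C = id\<close> can be read off from \<open>B\<close>,
  while \<open>b\<close> is a nonzero vector in the kernel of \<open>A\<close>.
\<close>

lemma infinite_basis_imp_noninjective_right_invertible: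
  assumes indep: "independent B" and span: "span B = UNIV" and inf: "infinite B"
  shows "\<exists>A. linear_operator scale A \<and> right_sided_invertible scale A \<and> \<not> invertible_operator A"
proof -
  interpret p: vector_space_pair scale scale by unfold_locales
  obtain b where b: "b \<in> B"
    using inf by fastforce
  obtain h where h: "bij_betw h B (B - {b})"
    using infinite_imp_bij_betw[OF inf] by blast
  define C where "C = p.construct B h"
  define A where "A = p.construct B (\<lambda>v. if v = b then 0 else the_inv_into B h v)"
  have linC: "Vector_Spaces.linear scale scale C"
    unfolding C_def by (rule p.linear_construct[OF indep])
  have linA: "Vector_Spaces.linear scale scale A"
    unfolding A_def by (rule p.linear_construct[OF indep])
  have AC_basis: "(A \<circ> C) v = id v" if v: "v \<in> B" for v
  proof -
    have hv: "h v \<in> B - {b}"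
      using bij_betwE[OF h] v by blast
    moreover have "the_inv_into B h (h v) = v"
      using h v by (simp add: bij_betw_def the_inv_into_f_f)
    ultimately show ?thesis
      using v by (simp add: A_def C_def p.construct_basis[OF indep])
  qed
  have "A \<circ> C = id"
  proof
    fix x
    show "(A \<circ> C) x = id x"
    proof (rule p.linear_eq_on[where x = x])
      show "Vector_Spaces.linear scale scale (A \<circ> C)"
        using linC linA by (rule Vector_Spaces.linear_compose)
      show "Vector_Spaces.linear scale scale id"
        by (fact linear_id)
      show "x \<in> span B"
        by (simp add: span)
    qed (rule AC_basis)
  qed
  moreover have "\<not> inj A"
  proof
    assume "inj A"
    moreover have "A b = A 0"
      using b p.linear_0[OF linA] by (simp add: A_def p.construct_basis[OF indep])
    ultimately have "b = 0"
      by (rule injD)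
    thus False
      using b indep dependent_zero[of B] by simp
  qed
  ultimately show ?thesis
    using linA linC
    unfolding linear_operator_def right_sided_invertible_def invertible_operator_def by blast
qed

lemma finite_dimensional_iff_right_invertible_imp_invertible:
  "finite_dimensional scale \<longleftrightarrow>
    (\<forall>A. linear_operator scale A \<and> right_sided_invertible scale A \<longrightarrow> invertible_operator A)"
    (is "_ \<longleftrightarrow> ?dedekind_finite")
proof
  assume "finite_dimensional scale"
  then obtain D where "finite_dimensional_vector_space scale D"
    unfolding finite_dimensional_def by blast
  thus ?dedekind_finite
    using finite_dimensional_vector_space.right_sided_invertible_imp_invertible[of scale D]
    by simp
next
  assume *: ?dedekind_finite
  obtain B where indep: "independent B" and span: "span B = UNIV"
    using maximal_independent_subset[of UNIV] by (metis top.extremum_uniqueI)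
  have "finite B"
    using infinite_basis_imp_noninjective_right_invertible[OF indep span] * by blast
  hence "finite_dimensional_vector_space scale B"
    using indep span
    by (intro finite_dimensional_vector_space.intro finite_dimensional_vector_space_axioms.intro
        vector_space_axioms)
  thus "finite_dimensional scale"
    unfolding finite_dimensional_def by blast
qed

end

theorem theorem3p1:
  fixes sR :: "real \<Rightarrow> 'a::ab_group_add \<Rightarrow> 'a"
    and sC :: "complex \<Rightarrow> 'b::ab_group_add \<Rightarrow> 'b"
  shows "(vector_space sR \<longrightarrow>
            (finite_dimensional sR \<longleftrightarrow>
              (\<forall>A. linear_operator sR A \<and> right_sided_invertible sR A \<longrightarrow> invertible_operator A)))
       \<and> (vector_space sC \<longrightarrow>
            (finite_dimensional sC \<longleftrightarrow>
              (\<forall>A. linear_operator sC A \<and> right_sided_invertible sC A \<longrightarrow> invertible_operator A)))"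
  by (intro conjI impI vector_space.finite_dimensional_iff_right_invertible_imp_invertible)

end
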